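(* Let $G$ be a finite simple connected diamond-free graph of order $n\ge 42$. Then \[\sqrt{s^+(G)} \le \sum_{v\in V(G)}\left(1-\frac{1}{c(v)}\right).\]
   Context: The diamond is the graph $K_4$ minus one edge; $G$ is diamond-free if it contains no diamond as a (not necessarily induced) subgraph. $s^+(G)=\sum_{\lambda_i>0}\lambda_i^2$, summing over the positive adjacency eigenvalues of $G$. For a vertex $v$, $c(v)$ is the order of the largest clique of $G$ containing $v$. *)

theory Defs
  imports
    "Graph_Theory.Graph_Theory"
    "Jordan_Normal_Form.Char_Poly"
begin

text \<open>
  Finite simple graphs are \<^locale>\<open>pair_graph\<close>s: finite, loop-free, symmetric digraphs whose arcs
  are pairs of vertices, so that an edge \<open>uv\<close> is the pair of arcs \<open>(u, v)\<close> and \<open>(v, u)\<close>.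
\<close>

definition is_diamond :: "'a pair_pre_digraph \<Rightarrow> bool" where
  "is_diamond H \<longleftrightarrow> (\<exists>a b c d. distinct [a, b, c, d] \<and> pverts H = {a, b, c, d} \<and>
     parcs H = {(x, y) \<in> pverts H \<times> pverts H. x \<noteq> y} - {(c, d), (d, c)})"

definition diamond_free :: "'a pair_pre_digraph \<Rightarrow> bool" where
  "diamond_free G \<longleftrightarrow> \<not> (\<exists>H :: 'a pair_pre_digraph.
     is_diamond H \<and> subgraph (with_proj H) (with_proj G))"

definition is_clique :: "'a pair_pre_digraph \<Rightarrow> 'a set \<Rightarrow> bool" where
  "is_clique G K \<longleftrightarrow> K \<subseteq> pverts G \<and> (\<forall>u\<in>K. \<forall>v\<in>K. u \<noteq> v \<longrightarrow> (u, v) \<in> parcs G)"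

definition clique_order_at :: "'a pair_pre_digraph \<Rightarrow> 'a \<Rightarrow> nat" where
  "clique_order_at G v = Max {card K | K. is_clique G K \<and> v \<in> K}"

definition adjacency_matrix_wrt :: "'a pair_pre_digraph \<Rightarrow> 'a list \<Rightarrow> real mat" where
  "adjacency_matrix_wrt G vs =
     mat (length vs) (length vs) (\<lambda>(i, j). if (vs ! i, vs ! j) \<in> parcs G then 1 else 0)"

text \<open>
  Matrices are indexed by natural numbers, so the vertices have to be enumerated. The choice of the
  enumeration does not affect the spectrum, see \<open>char_poly_adjacency_matrix\<close> below.
\<close>

definition adjacency_matrix :: "'a pair_pre_digraph \<Rightarrow> real mat" where
  "adjacency_matrix G =
     adjacency_matrix_wrt G (SOME vs. distinct vs \<and> set vs = pverts G)"

text \<open>The roots of the characteristic polynomial, counted with multiplicity.\<close>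

definition adjacency_eigenvalues :: "'a pair_pre_digraph \<Rightarrow> real multiset" where
  "adjacency_eigenvalues G = proots (char_poly (adjacency_matrix G))"

definition s_plus :: "'a pair_pre_digraph \<Rightarrow> real" where
  "s_plus G = (\<Sum>x\<in>#filter_mset (\<lambda>x. x > 0) (adjacency_eigenvalues G). x\<^sup>2)"

lemma char_poly_adjacency_matrix_wrt:
  assumes xs: "distinct xs" and ys: "distinct ys" and eq: "set xs = set ys"
  shows "char_poly (adjacency_matrix_wrt G xs) = char_poly (adjacency_matrix_wrt G ys)"
proof -
  define n where "n = length xs"
  have "mset ys = mset xs"
    using xs ys eq set_eq_iff_mset_eq_distinct by metis
  then obtain p where p: "p permutes {..<n}" and perm: "permute_list p xs = ys"
    unfolding n_def by (rule mset_eq_permutation)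
  have len: "length ys = n"
    using perm n_def by auto
  have nth: "ys ! i = xs ! p i" if "i < n" for i
    using that p perm permute_list_nth[of p xs i] by (auto simp: n_def)
  have pn: "p i < n" if "i < n" for i
    using permutes_in_image[OF p, of i] that by auto
  have inj: "p i = p j \<longleftrightarrow> i = j" for i j
    using permutes_inj[OF p] by (auto dest: injD)
  define A where "A = adjacency_matrix_wrt G xs"
  define B where "B = adjacency_matrix_wrt G ys"
  define P :: "real mat" where "P = mat n n (\<lambda>(i, j). if j = p i then 1 else 0)"
  define Q :: "real mat" where "Q = mat n n (\<lambda>(i, j). if i = p j then 1 else 0)"
  have carr: "A \<in> carrier_mat n n" "B \<in> carrier_mat n n" "P \<in> carrier_mat n n" "Q \<in> carrier_mat n n"
    unfolding A_def B_def P_def Q_def adjacency_matrix_wrt_def using len n_def by auto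
  have PA: "P * A = mat n n (\<lambda>(i, j). A $$ (p i, j))"
    using carr pn
    by (intro eq_matI) (auto simp: P_def scalar_prod_def if_distrib[where f = "\<lambda>x. x * _"] cong: if_cong)
  have "P * A * Q = B"
    unfolding PA using carr pn nth len n_def
    by (intro eq_matI)
       (auto simp: Q_def scalar_prod_def if_distrib[where f = "\<lambda>x. _ * x"] B_def A_def
          adjacency_matrix_wrt_def cong: if_cong)
  moreover have PQ: "P * Q = 1\<^sub>m n"
    using carr pn
    by (intro eq_matI)
       (auto simp: P_def Q_def scalar_prod_def if_distrib[where f = "\<lambda>x. x * _"] inj cong: if_cong)
  moreover have "Q * P = 1\<^sub>m n"
    using mat_mult_left_right_inverse[OF carr(3) carr(4) PQ] .
  ultimately have "similar_mat_wit B A P Q"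
    using carr by (intro similar_mat_witI[of P Q n]) auto
  then have "similar_mat B A"
    unfolding similar_mat_def by blast
  from char_poly_similar[OF this] show ?thesis
    by (simp add: A_def B_def)
qed

lemma char_poly_adjacency_matrix:
  assumes "distinct vs" and "set vs = pverts G"
  shows "char_poly (adjacency_matrix G) = char_poly (adjacency_matrix_wrt G vs)"
proof -
  let ?ws = "SOME vs. distinct vs \<and> set vs = pverts G"
  have "distinct ?ws \<and> set ?ws = pverts G"
    by (rule someI[of "\<lambda>vs. distinct vs \<and> set vs = pverts G" vs]) (use assms in blast)
  then show ?thesis
    unfolding adjacency_matrix_def
    by (intro char_poly_adjacency_matrix_wrt) (use assms in auto)
qed

end

theory Submission
  imports Defs "Jordan_Normal_Form.Schur_Decomposition" "HOL-Analysis.Convex"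
begin

text \<open>
  Let \<open>t\<close> be the number of vertices lying on triangles. Every vertex has \<open>c(v) \<ge> 2\<close>, and \<open>c(v) \<ge> 3\<close> on
  triangles, so the right-hand side is at least \<open>n/2 + t/6\<close>. Since two triangles never share an edge,
  \<open>tr A\<^sup>3 \<le> t\<^sup>2\<close>. Let \<open>a = 2m/n\<close> be the mean degree and \<open>b\<^sup>2\<close> the sum of the squares of the negative
  eigenvalues; as \<open>tr A\<^sup>2 = 2m\<close>, we have \<open>s\<^sup>+ = n a - b\<^sup>2\<close>. The spectral radius is at least \<open>a\<close>. If it is
  attained at a negative eigenvalue, then \<open>a \<le> b\<close> and \<open>s\<^sup>+ \<le> n b - b\<^sup>2 \<le> n\<^sup>2/4\<close>. Otherwise comparing cubes
  of eigenvalues gives \<open>a\<^sup>3 \<le> b\<^sup>3 + t\<^sup>2\<close>, which again bounds \<open>n a - b\<^sup>2\<close>.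
\<close>

section \<open>Traces and spectra\<close>

lemma index_mult_mat_sum:
  assumes "A \<in> carrier_mat n m" "B \<in> carrier_mat m k" "i < n" "j < k"
  shows "(A * B) $$ (i, j) = (\<Sum>l<m. A $$ (i, l) * B $$ (l, j))"
  using assms by (simp add: scalar_prod_def atLeast0LessThan)

lemma trace_mult_comm:
  fixes A B :: "'a::comm_semiring_0 mat"
  assumes A: "A \<in> carrier_mat n m" and B: "B \<in> carrier_mat m n"
  shows "(\<Sum>i<n. (A * B) $$ (i, i)) = (\<Sum>i<m. (B * A) $$ (i, i))"
proof -
  have "(\<Sum>i<n. (A * B) $$ (i, i)) = (\<Sum>i<n. \<Sum>l<m. A $$ (i, l) * B $$ (l, i))"
    using A B by (intro sum.cong) (auto simp: index_mult_mat_sum simp del: index_mult_mat)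
  also have "\<dots> = (\<Sum>l<m. \<Sum>i<n. B $$ (l, i) * A $$ (i, l))"
    by (subst sum.swap) (simp add: mult.commute)
  also have "\<dots> = (\<Sum>i<m. (B * A) $$ (i, i))"
    using A B by (intro sum.cong) (auto simp: index_mult_mat_sum simp del: index_mult_mat)
  finally show ?thesis .
qed

lemma trace_similar:
  fixes A B :: "'a::comm_ring_1 mat"
  assumes A: "A \<in> carrier_mat n n" and sim: "similar_mat_wit A B P Q"
  shows "(\<Sum>i<n. A $$ (i, i)) = (\<Sum>i<n. B $$ (i, i))"
proof -
  note w = similar_mat_witD2[OF A sim]
  have "(\<Sum>i<n. A $$ (i, i)) = (\<Sum>i<n. (P * (B * Q)) $$ (i, i))"
    using w(3) assoc_mult_mat[OF w(6) w(5) w(7)] by simp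
  also have "\<dots> = (\<Sum>i<n. ((B * Q) * P) $$ (i, i))"
    using w by (intro trace_mult_comm) auto
  also have "(B * Q) * P = B * (Q * P)"
    using w by (intro assoc_mult_mat) auto
  also have "B * (Q * P) = B"
    using w by simp
  finally show ?thesis .
qed

text \<open>In a product of upper triangular matrices, the term with middle index \<open>l\<close>
  of entry \<open>(i, j)\<close> vanishes unless \<open>i \<le> l \<le> j\<close>; on the diagonal
  only \<open>l = i\<close> survives.\<close>

lemma upper_triangular_pow:
  fixes B :: "'a::comm_ring_1 mat"
  assumes B: "B \<in> carrier_mat n n" and ut: "upper_triangular B"
  shows "upper_triangular (B ^\<^sub>m k) \<and> (\<forall>i<n. (B ^\<^sub>m k) $$ (i, i) = (B $$ (i, i)) ^ k)"
proof (induction k)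
  case 0
  show ?case using B by auto
next
  case (Suc k)
  define C where "C = B ^\<^sub>m k"
  have C: "C \<in> carrier_mat n n" using B by (simp add: C_def)
  have C0: "C $$ (i, l) = 0" if "l < i" "i < n" for i l
    using Suc that C unfolding C_def[symmetric] by auto
  have B0: "B $$ (i, l) = 0" if "l < i" "i < n" for i l
    using ut that B by auto
  have low: "(C * B) $$ (i, j) = 0" if "j < i" "i < n" for i j
  proof -
    have "(C * B) $$ (i, j) = (\<Sum>l<n. C $$ (i, l) * B $$ (l, j))"
      using C B that by (intro index_mult_mat_sum[of _ n n _ n]) auto
    also have "\<dots> = 0"
    proof (intro sum.neutral ballI)
      fix l assume "l \<in> {..<n}"
      then show "C $$ (i, l) * B $$ (l, j) = 0"
        using C0[of l i] B0[of j l] that by (cases "l < i") auto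
    qed
    finally show ?thesis .
  qed
  have diag: "(C * B) $$ (i, i) = (B $$ (i, i)) ^ Suc k" if "i < n" for i
  proof -
    have "(C * B) $$ (i, i) = (\<Sum>l<n. C $$ (i, l) * B $$ (l, i))"
      using C B that by (intro index_mult_mat_sum[of _ n n _ n]) auto
    also have "\<dots> = (\<Sum>l\<in>{i}. C $$ (i, l) * B $$ (l, i))"
    proof (intro sum.mono_neutral_right ballI)
      fix l assume "l \<in> {..<n} - {i}"
      then show "C $$ (i, l) * B $$ (l, i) = 0"
        using C0[of l i] B0[of i l] that by (cases "l < i") auto
    qed (use that in auto)
    finally show ?thesis
      using Suc that by (simp add: C_def mult.commute)
  qed
  show ?case
    using low diag C by (auto simp: C_def[symmetric])
qed

text \<open>Schur triangularisation puts \<open>es\<close> on the diagonal of an upper triangular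
  matrix similar to \<open>A\<close>. Its powers carry the powers of \<open>es\<close> on the
  diagonal, and similarity preserves the trace.\<close>

lemma trace_pow_eq_sum_eigenvalues:
  fixes A :: "'a::conjugatable_ordered_field mat"
  assumes A: "A \<in> carrier_mat n n" and c: "char_poly A = (\<Prod>e\<leftarrow>es. [:- e, 1:])"
  shows "(\<Sum>i<n. (A ^\<^sub>m k) $$ (i, i)) = (\<Sum>e\<leftarrow>es. e ^ k)"
proof -
  obtain B P Q where BPQ: "schur_decomposition A es = (B, P, Q)"
    by (metis prod_cases3)
  from schur_decomposition[OF A c this]
  have sim: "similar_mat_wit A B P Q" and ut: "upper_triangular B" and d: "diag_mat B = es"
    by auto
  have B: "B \<in> carrier_mat n n" using similar_mat_witD2[OF A sim] by auto
  have "(\<Sum>i<n. (A ^\<^sub>m k) $$ (i, i)) = (\<Sum>i<n. (B ^\<^sub>m k) $$ (i, i))"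
    using A by (intro trace_similar[OF _ similar_mat_wit_pow[OF sim]]) auto
  also have "\<dots> = (\<Sum>i<n. (B $$ (i, i)) ^ k)"
    using upper_triangular_pow[OF B ut] by auto
  also have "\<dots> = (\<Sum>e\<leftarrow>es. e ^ k)"
    using B unfolding d[symmetric] diag_mat_def
    by (simp add: interv_sum_list_conv_sum_set_nat atLeast0LessThan comp_def)
  finally show ?thesis .
qed

text \<open>Translates between the multiset behind \<open>adjacency_eigenvalues\<close> and the list
  \<open>es\<close> used for the trace formulas.\<close>

lemma proots_prod_linear_factors:
  fixes es :: "'a::idom list"
  shows "proots (\<Prod>e\<leftarrow>es. [:- e, 1:]) = mset es"
proof (induction es)
  case (Cons a es)
  have "(\<Prod>e\<leftarrow>es. [:- e, 1:]) \<noteq> 0"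
    by (auto simp: prod_list_zero_iff)
  then show ?case
    using Cons proots_mult[of "[:- a, 1:]" "\<Prod>e\<leftarrow>es. [:- e, 1:]"] by simp
qed simp

section \<open>Real symmetric matrices\<close>

text \<open>The Hermitian form \<open>q\<close> of an eigenvector \<open>v\<close> equals
  \<open>z\<close> times the squared norm \<open>r\<close>, and symmetry of the real matrix makes
  \<open>q\<close> its own conjugate. As \<open>r\<close> is nonzero, \<open>z\<close> is a quotient
  of reals.\<close>

lemma eigenvalue_real_symmetric_is_real:
  fixes A :: "real mat" and z :: complex
  assumes A: "A \<in> carrier_mat n n" and sym: "transpose_mat A = A"
    and ev: "eigenvalue (map_mat complex_of_real A) z"
  shows "z \<in> \<real>"
proof -
  from ev obtain v where v: "v \<in> carrier_vec n" "v \<noteq> 0\<^sub>v n"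
    and eq: "map_mat complex_of_real A *\<^sub>v v = z \<cdot>\<^sub>v v"
    using A unfolding eigenvalue_def eigenvector_def by auto
  have s: "A $$ (i, j) = A $$ (j, i)" if "i < n" "j < n" for i j
    using that A sym by (metis carrier_matD index_transpose_mat(1))
  define q where "q = (\<Sum>i<n. \<Sum>j<n. cnj (v $ i) * (of_real (A $$ (i, j)) * v $ j))"
  define r where "r = (\<Sum>i<n. (cmod (v $ i))\<^sup>2)"
  have row: "(\<Sum>j<n. of_real (A $$ (i, j)) * v $ j) = z * v $ i" if "i < n" for i
    using arg_cong[OF eq, of "\<lambda>w. w $ i"] that A v by (simp add: scalar_prod_def atLeast0LessThan)
  have "q = (\<Sum>i<n. cnj (v $ i) * (z * v $ i))"
    unfolding q_def sum_distrib_left[symmetric] using row by simp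
  also have "\<dots> = z * of_real r"
    by (simp add: r_def sum_distrib_left complex_norm_square mult_ac del: of_real_power)
  finally have qz: "q = z * of_real r" .
  have "cnj q = (\<Sum>i<n. \<Sum>j<n. cnj (v $ j) * (of_real (A $$ (i, j)) * v $ i))"
    by (simp add: q_def mult_ac)
  also have "\<dots> = (\<Sum>j<n. \<Sum>i<n. cnj (v $ j) * (of_real (A $$ (i, j)) * v $ i))"
    by (rule sum.swap)
  also have "\<dots> = q"
    unfolding q_def using s by (intro sum.cong refl) auto
  finally have "cnj q = q" .
  then have qR: "q \<in> \<real>" by (simp add: Reals_cnj_iff)
  obtain i where i: "i < n" "v $ i \<noteq> 0"
    using v by (metis carrier_vecD eq_vecI index_zero_vec)
  have "r \<noteq> 0"
    using i unfolding r_def by (subst sum_nonneg_eq_0_iff) auto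
  then have "z = q / of_real r" using qz by simp
  then show ?thesis using qR by simp
qed

text \<open>The factorisation exists over the complex numbers and has only real roots. It is thus
  the image of a real factorisation, and the embedding of polynomials is injective.\<close>

lemma char_poly_real_symmetric_splits:
  fixes A :: "real mat"
  assumes A: "A \<in> carrier_mat n n" and sym: "transpose_mat A = A"
  obtains es where "char_poly A = (\<Prod>e\<leftarrow>es. [:- e, 1:])" "length es = n"
proof -
  let ?C = "map_mat complex_of_real A"
  have C: "?C \<in> carrier_mat n n" using A by simp
  obtain as where as: "char_poly ?C = (\<Prod>a\<leftarrow>as. [:- a, 1:])" "length as = n"
    using char_poly_factorized[OF C] by auto
  have real: "a = of_real (Re a)" if "a \<in> set as" for a
  proof -
    have "poly (char_poly ?C) a = 0"
      using that unfolding as(1) by (auto simp: poly_prod_list prod_list_zero_iff)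
    then have "a \<in> \<real>"
      using eigenvalue_root_char_poly[OF C] eigenvalue_real_symmetric_is_real[OF A sym] by blast
    then show ?thesis by simp
  qed
  interpret h: map_poly_inj_comm_ring_hom complex_of_real ..
  define es where "es = map Re as"
  have "map_poly complex_of_real (char_poly A) = (\<Prod>a\<leftarrow>as. [:- a, 1:])"
    using of_real_hom.char_poly_hom[OF A] as(1) by metis
  also have "\<dots> = (\<Prod>e\<leftarrow>es. [:- of_real e, 1:])"
    unfolding es_def map_map comp_def using real
    by (intro arg_cong[of _ _ prod_list] map_cong) auto
  also have "\<dots> = map_poly complex_of_real (\<Prod>e\<leftarrow>es. [:- e, 1:])"
    by (simp add: h.hom_prod_list comp_def)
  finally have "char_poly A = (\<Prod>e\<leftarrow>es. [:- e, 1:])"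
    by (rule h.injectivity)
  then show ?thesis using that[of es] as(2) by (simp add: es_def)
qed

section \<open>Powers of a symmetric matrix and its spectral radius\<close>

lemma transpose_pow_mat:
  fixes A :: "'a::comm_semiring_1 mat"
  assumes A: "A \<in> carrier_mat n n" and sym: "transpose_mat A = A"
  shows "transpose_mat (A ^\<^sub>m k) = A ^\<^sub>m k"
proof (induction k)
  case (Suc k)
  have "transpose_mat (A ^\<^sub>m Suc k) = A * A ^\<^sub>m k"
    using A Suc sym by (simp add: transpose_mult[of _ n n _ n])
  also have "\<dots> = A ^\<^sub>m Suc k"
    using A by (induction k) (auto simp: assoc_mult_mat[of _ n n _ n _ n, symmetric])
  finally show ?case .
qed (use A in auto)

lemma pow_mat_double:
  assumes A: "A \<in> carrier_mat n n"
  shows "A ^\<^sub>m (2 * k) = A ^\<^sub>m k * A ^\<^sub>m k"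
proof -
  have "A ^\<^sub>m (k + l) = A ^\<^sub>m k * A ^\<^sub>m l" for l
    using A by (induction l) (auto simp: assoc_mult_mat[of _ n n _ n _ n])
  then show ?thesis by (simp add: mult_2)
qed

text \<open>
  For the entry sum \<open>S\<^sub>k\<close> of \<open>A\<^sup>k\<close>, Cauchy-Schwarz gives both \<open>S\<^sub>k\<^sup>2 \<le> n S\<^bsub>2k\<^esub>\<close> and
  \<open>S\<^sub>k\<^sup>2 \<le> n\<^sup>2 tr A\<^bsup>2k\<^esup> \<le> n\<^sup>3 \<rho>\<^bsup>2k\<^esup>\<close>; now let \<open>k\<close> run through the powers of 2.
\<close>

lemma sum_entries_le_spectral_radius:
  fixes A :: "real mat"
  assumes A: "A \<in> carrier_mat n n" and sym: "transpose_mat A = A"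
    and c: "char_poly A = (\<Prod>e\<leftarrow>es. [:- e, 1:])" "length es = n"
    and rho: "0 \<le> \<rho>" "\<And>e. e \<in> set es \<Longrightarrow> \<bar>e\<bar> \<le> \<rho>"
  shows "(\<Sum>i<n. \<Sum>j<n. A $$ (i, j)) \<le> n * \<rho>"
proof (rule ccontr)
  define S where "S k = (\<Sum>i<n. \<Sum>j<n. (A ^\<^sub>m k) $$ (i, j))" for k
  have car: "A ^\<^sub>m k \<in> carrier_mat n n" for k using A by simp
  have symk: "(A ^\<^sub>m k) $$ (i, j) = (A ^\<^sub>m k) $$ (j, i)" if "i < n" "j < n" for i j k
    using that car[of k] transpose_pow_mat[OF A sym, of k]
    by (metis carrier_matD index_transpose_mat(1))
  \<comment> \<open>Flipping one index by symmetry makes these entries inner products of columns, so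
    the traces and entry sums below become sums of squares.\<close>
  have ent: "(A ^\<^sub>m (2 * k)) $$ (i, j) = (\<Sum>l<n. (A ^\<^sub>m k) $$ (l, i) * (A ^\<^sub>m k) $$ (l, j))"
    if "i < n" "j < n" for i j k
    unfolding pow_mat_double[OF A] using that symk
    by (subst index_mult_mat_sum[OF car car]) auto
  have double: "(S k)\<^sup>2 \<le> S (2 * k) * n" for k
  proof -
    have "S (2 * k) = (\<Sum>i<n. \<Sum>j<n. \<Sum>l<n. (A ^\<^sub>m k) $$ (l, i) * (A ^\<^sub>m k) $$ (l, j))"
      unfolding S_def using ent by simp
    also have "\<dots> = (\<Sum>i<n. \<Sum>l<n. \<Sum>j<n. (A ^\<^sub>m k) $$ (l, i) * (A ^\<^sub>m k) $$ (l, j))"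
      by (intro sum.cong refl sum.swap)
    also have "\<dots> = (\<Sum>l<n. \<Sum>i<n. \<Sum>j<n. (A ^\<^sub>m k) $$ (l, i) * (A ^\<^sub>m k) $$ (l, j))"
      by (rule sum.swap)
    also have "\<dots> = (\<Sum>l<n. (\<Sum>i<n. (A ^\<^sub>m k) $$ (l, i))\<^sup>2)"
      by (simp add: power2_eq_square sum_product)
    finally show ?thesis
      using sum_squared_le_sum_of_squares[of "\<lambda>l. \<Sum>i<n. (A ^\<^sub>m k) $$ (l, i)" "{..<n}"]
      by (simp add: S_def)
  qed
  have upper: "(S k)\<^sup>2 \<le> n ^ 3 * \<rho> ^ (2 * k)" for k
  proof -
    have "(S k)\<^sup>2 = (\<Sum>(i, j)\<in>{..<n} \<times> {..<n}. (A ^\<^sub>m k) $$ (i, j))\<^sup>2"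
      by (simp add: S_def sum.cartesian_product)
    also have "\<dots> \<le> (\<Sum>(i, j)\<in>{..<n} \<times> {..<n}. ((A ^\<^sub>m k) $$ (i, j))\<^sup>2) * (n * n)"
      using sum_squared_le_sum_of_squares[of "\<lambda>(i, j). (A ^\<^sub>m k) $$ (i, j)" "{..<n} \<times> {..<n}"]
      by (simp add: case_prod_unfold)
    also have "(\<Sum>(i, j)\<in>{..<n} \<times> {..<n}. ((A ^\<^sub>m k) $$ (i, j))\<^sup>2) = (\<Sum>j<n. (A ^\<^sub>m (2 * k)) $$ (j, j))"
      unfolding sum.cartesian_product[symmetric]
      by (subst sum.swap) (simp add: ent power2_eq_square)
    also have "\<dots> = (\<Sum>e\<leftarrow>es. e ^ (2 * k))"
      by (rule trace_pow_eq_sum_eigenvalues[OF A c(1)])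
    also have "\<dots> \<le> (\<Sum>e\<leftarrow>es. \<rho> ^ (2 * k))"
    proof (rule sum_list_mono)
      fix e assume "e \<in> set es"
      then have "\<bar>e\<bar> ^ (2 * k) \<le> \<rho> ^ (2 * k)"
        using rho by (intro power_mono) auto
      then show "e ^ (2 * k) \<le> \<rho> ^ (2 * k)" by (simp add: power_mult)
    qed
    also have "\<dots> = n * \<rho> ^ (2 * k)"
      using c(2) by (simp add: sum_list_triv)
    finally show ?thesis by (simp add: mult_right_mono power3_eq_cube mult_ac)
  qed
  assume "\<not> ?thesis"
  then have S1: "S 1 > n * \<rho>" using A by (simp add: S_def)
  then have n: "n > 0" by (cases n) (auto simp: S_def)
  \<comment> \<open>The mean row sum, which exceeds \<open>\<rho>\<close> under the negated goal.
    Its powers are now compared with those of \<open>\<rho>\<close>.\<close>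
  define a where "a = S 1 / n"
  have a: "a > \<rho>" using S1 n by (simp add: a_def field_simps)
  have low: "n * a ^ (2 ^ j) \<le> S (2 ^ j)" for j
  proof (induction j)
    case 0
    then show ?case using n by (simp add: a_def)
  next
    case (Suc j)
    have "(n * a ^ (2 ^ j))\<^sup>2 \<le> (S (2 ^ j))\<^sup>2"
      using Suc a rho by (intro power_mono) auto
    also have "\<dots> \<le> S (2 ^ Suc j) * n" using double[of "2 ^ j"] by simp
    finally have "n * (n * (a ^ (2 ^ j))\<^sup>2) \<le> n * S (2 ^ Suc j)"
      by (simp add: power2_eq_square mult_ac)
    then have "n * (a ^ (2 ^ j))\<^sup>2 \<le> S (2 ^ Suc j)" using n by simp
    then show ?case by (simp add: power_mult[symmetric] mult.commute)
  qed
  have bound: "a ^ (2 ^ Suc j) \<le> n * \<rho> ^ (2 ^ Suc j)" for j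
  proof -
    have "(n * a ^ (2 ^ j))\<^sup>2 \<le> (S (2 ^ j))\<^sup>2"
      using low[of j] a rho by (intro power_mono) auto
    also have "\<dots> \<le> n ^ 3 * \<rho> ^ (2 * 2 ^ j)" by (rule upper)
    finally have "(n * n) * (a ^ (2 ^ j))\<^sup>2 \<le> (n * n) * (n * \<rho> ^ (2 ^ Suc j))"
      by (simp add: power2_eq_square power3_eq_cube mult_ac)
    then have "(a ^ (2 ^ j))\<^sup>2 \<le> n * \<rho> ^ (2 ^ Suc j)"
      using n by simp
    then show ?thesis by (simp add: power_mult[symmetric] mult.commute)
  qed
  \<comment> \<open>Positivity is needed to divide by \<open>\<rho>\<close>; the case
    \<open>\<rho> = 0\<close> is refuted by \<open>bound\<close> at exponent 2.\<close>
  have rpos: "\<rho> > 0"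
  proof (rule ccontr)
    assume "\<not> \<rho> > 0"
    then have "\<rho> = 0" using rho by simp
    then have "a ^ (2 ^ Suc 0) \<le> 0" using bound[of 0] by simp
    moreover have "a ^ (2 ^ Suc 0) > 0" using a rho by simp
    ultimately show False by simp
  qed
  \<comment> \<open>By \<open>bound\<close>, infinitely many powers of this ratio stay below the
    constant \<open>n\<close>, which is impossible for a ratio above 1.\<close>
  have "a / \<rho> > 1" using a rpos by simp
  then obtain m where m: "real n < (a / \<rho>) ^ m" using real_arch_pow by blast
  have "(a / \<rho>) ^ m \<le> (a / \<rho>) ^ (2 ^ Suc m)"
    using \<open>a / \<rho> > 1\<close> less_exp[of "Suc m"] by (intro power_increasing) auto
  also have "\<dots> \<le> n"
    using bound[of m] rpos by (simp add: power_divide divide_le_eq del: power_Suc)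
  finally show False using m by simp
qed

section \<open>The numerical estimate\<close>

text \<open>
  In the notation of the introduction, \<open>n a - b\<^sup>2 > (n/2 + t/6)\<^sup>2\<close> forces \<open>a > b + t/6\<close> and
  \<open>a > n/4 + t/6\<close>, hence \<open>a\<^sup>3 - b\<^sup>3 > (t/6) (n/4 + t/6)\<^sup>2 \<ge> n t\<^sup>2/36\<close>.
\<close>

lemma sum_squares_pos_le:
  fixes es :: "real list" and n t :: real
  assumes n: "n \<ge> 42" and t: "t \<ge> 0"
    and cub: "(\<Sum>e\<leftarrow>es. e ^ 3) \<le> t\<^sup>2"
    and big: "e0 \<in> set es" "(\<Sum>e\<leftarrow>es. e\<^sup>2) \<le> n * \<bar>e0\<bar>"
  shows "(\<Sum>e\<leftarrow>filter (\<lambda>e. e > 0) es. e\<^sup>2) \<le> (n / 2 + t / 6)\<^sup>2"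
proof (rule ccontr)
  define p where "p = filter (\<lambda>e. e > 0) es"
  \<comment> \<open>Zero eigenvalues are included here; they contribute nothing to the sums of
    squares and cubes.\<close>
  define q where "q = filter (\<lambda>e. \<not> e > 0) es"
  define P where "P = (\<Sum>e\<leftarrow>p. e\<^sup>2)"
  define b where "b = sqrt (\<Sum>e\<leftarrow>q. e\<^sup>2)"
  have split: "(\<Sum>e\<leftarrow>es. f e) = (\<Sum>e\<leftarrow>p. f e) + (\<Sum>e\<leftarrow>q. f e)" for f :: "real \<Rightarrow> real"
    unfolding p_def q_def by (induction es) auto
  have b0: "b \<ge> 0" and b2: "b\<^sup>2 = (\<Sum>e\<leftarrow>q. e\<^sup>2)"
    unfolding b_def by (auto intro!: sum_list_nonneg)
  define a where "a = (P + b\<^sup>2) / n"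
  have Pa: "P = n * a - b\<^sup>2" using n by (simp add: a_def)
  have ae: "a \<le> \<bar>e0\<bar>"
    using big(2) n split[of "\<lambda>e. e\<^sup>2"] by (simp add: a_def P_def b2 divide_le_eq mult.commute)
  have mem: "e\<^sup>2 \<le> b\<^sup>2" if "e \<in> set q" for e
    unfolding b2 using that by (intro member_le_sum_list) auto
  assume "\<not> ?thesis"
  then have "P > (n / 2 + t / 6)\<^sup>2" by (simp add: P_def p_def)
  also have "(n / 2 + t / 6)\<^sup>2 = n * (n / 4 + t / 6) + t\<^sup>2 / 36"
    by (simp add: power2_eq_square field_simps)
  finally have "n * (n / 4 + t / 6) < n * a - b\<^sup>2"
    using Pa by (smt (verit) zero_le_power2 divide_nonneg_pos)
  then have main: "n * (n / 4 + t / 6) + b\<^sup>2 < n * a" by simp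
  then have "n * (n / 4 + t / 6) < n * a" by (smt (verit) zero_le_power2)
  then have a1: "a > n / 4 + t / 6" using n by simp
  \<comment> \<open>The square of \<open>n / 2 - b\<close> is nonnegative, hence
    \<open>n * b\<close> is at most \<open>n\<^sup>2 / 4 + b\<^sup>2\<close>.\<close>
  have "n * (b + t / 6) \<le> n * (n / 4 + t / 6) + b\<^sup>2"
    using zero_le_power2[of "n / 2 - b"] by (simp add: power2_eq_square algebra_simps)
  then have "n * (b + t / 6) < n * a" using main by simp
  then have ab: "a > b + t / 6" using n by simp
  \<comment> \<open>Otherwise \<open>e0\<close> is one of the entries of \<open>q\<close>, so
    \<open>a \<le> \<bar>e0\<bar> \<le> b\<close>, against \<open>ab\<close>.\<close>
  have e0: "e0 > 0"
  proof (rule ccontr)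
    assume "\<not> e0 > 0"
    then have "\<bar>e0\<bar> \<le> b" using mem[of e0] big(1) b0 abs_le_square_iff[of e0 b] by (auto simp: q_def)
    then show False using ab ae t by simp
  qed
  have "a ^ 3 \<le> e0 ^ 3" using ae e0 a1 n t by (intro power_mono) auto
  also have "\<dots> \<le> (\<Sum>e\<leftarrow>p. e ^ 3)"
    using e0 big(1) by (intro member_le_sum_list) (auto simp: p_def)
  finally have pos_le: "a ^ 3 \<le> (\<Sum>e\<leftarrow>p. e ^ 3)" .
  \<comment> \<open>Each entry of \<open>q\<close> has absolute value at most \<open>b\<close>, so
    one factor of every cube can be replaced by \<open>b\<close>.\<close>
  have "- (\<Sum>e\<leftarrow>q. e ^ 3) = (\<Sum>e\<leftarrow>q. - (e ^ 3))" by (simp add: uminus_sum_list_map comp_def)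
  also have "\<dots> \<le> (\<Sum>e\<leftarrow>q. b * e\<^sup>2)"
  proof (rule sum_list_mono)
    fix e assume "e \<in> set q"
    then have "- e \<le> b" using mem[of e] b0 abs_le_square_iff[of e b] by simp
    then have "(- e) * e\<^sup>2 \<le> b * e\<^sup>2" by (intro mult_right_mono) auto
    then show "- (e ^ 3) \<le> b * e\<^sup>2" by (simp add: power3_eq_cube power2_eq_square)
  qed
  also have "\<dots> = b ^ 3"
    unfolding sum_list_const_mult b2[symmetric] by (simp add: power3_eq_cube power2_eq_square)
  finally have le: "a ^ 3 - b ^ 3 \<le> t\<^sup>2"
    using pos_le cub split[of "\<lambda>e. e ^ 3"] by simp
  have fac: "a ^ 3 - b ^ 3 = (a - b) * (a\<^sup>2 + (a * b + b\<^sup>2))"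
    by (simp add: power3_eq_cube power2_eq_square algebra_simps)
  have apos: "a > 0" using a1 n t by simp
  \<comment> \<open>The constant 7 is 42/6: the square of a sum is at least four times the product,
    here \<open>n * t / 6\<close>.\<close>
  have am: "(n / 4 + t / 6)\<^sup>2 \<ge> 7 * t"
  proof -
    have "(n / 4 + t / 6)\<^sup>2 = (n / 4 - t / 6)\<^sup>2 + n * t / 6"
      by (simp add: power2_eq_square algebra_simps)
    moreover have "n * t \<ge> 42 * t" using n t by (intro mult_right_mono) auto
    ultimately show ?thesis using zero_le_power2[of "n / 4 - t / 6"] by linarith
  qed
  also have "(n / 4 + t / 6)\<^sup>2 \<le> a\<^sup>2" using a1 n t by (intro power_mono) auto
  finally have a7: "7 * t \<le> a\<^sup>2" .
  have pos: "a\<^sup>2 + (a * b + b\<^sup>2) > 0"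
    using apos b0 by (simp add: add_pos_nonneg)
  \<comment> \<open>The chain ends in \<open>7 * t\<^sup>2 / 6 < t\<^sup>2\<close>. The strict
    inequality in it makes this absurd for \<open>t = 0\<close> as well.\<close>
  have "(t / 6) * (7 * t) \<le> (t / 6) * (a\<^sup>2 + (a * b + b\<^sup>2))"
    using a7 apos b0 t by (intro mult_left_mono) (auto intro: add_increasing2)
  also have "\<dots> < (a - b) * (a\<^sup>2 + (a * b + b\<^sup>2))"
    using ab pos by (intro mult_strict_right_mono) auto
  also have "\<dots> \<le> t\<^sup>2" using le fac by simp
  finally have "t * t * 7 < 6 * (t * t)" by (simp add: power2_eq_square)
  then show False using zero_le_square[of t] by linarith
qed

section \<open>Diamond-free graphs\<close>

lemma pair_graph_arc_sym:
  assumes "pair_graph G" "(u, v) \<in> parcs G"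
  shows "(v, u) \<in> parcs G"
proof -
  interpret pair_graph G by fact
  show ?thesis using pair_sym_arcs assms(2) by (auto simp: symmetric_def dest: symD)
qed

text \<open>Two distinct common neighbours \<open>c\<close>, \<open>d\<close> of the edge
  \<open>ab\<close> would give a diamond with missing edge \<open>cd\<close>. Since subgraphs need
  not be induced, it is irrelevant whether \<open>cd\<close> is an edge of \<open>G\<close>.\<close>

lemma diamond_free_common_neighbour_unique:
  assumes G: "pair_graph G" and free: "diamond_free G"
    and arcs: "(a, b) \<in> parcs G" "(a, c) \<in> parcs G" "(b, c) \<in> parcs G"
      "(a, d) \<in> parcs G" "(b, d) \<in> parcs G"
  shows "c = d"
proof (rule ccontr)
  assume cd: "c \<noteq> d"
  interpret pair_graph G by fact
  have irr: "x \<noteq> y" if "(x, y) \<in> parcs G" for x y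
    using pair_no_loops[OF that] by simp
  have dist: "distinct [a, b, c, d]"
    using cd irr arcs by auto
  define H where "H = \<lparr>pverts = {a, b, c, d},
    parcs = {(x, y) \<in> {a, b, c, d} \<times> {a, b, c, d}. x \<noteq> y} - {(c, d), (d, c)}\<rparr>"
  have "is_diamond H"
    unfolding is_diamond_def H_def using dist by (intro exI[of _ a] exI[of _ b] exI[of _ c] exI[of _ d]) simp
  moreover have "subgraph (with_proj H) (with_proj G)"
  proof -
    have "pverts H \<subseteq> pverts G"
      using arcs in_arcsD1 in_arcsD2 by (auto simp: H_def)
    moreover have "parcs H \<subseteq> parcs G"
      using arcs arcs[THEN pair_graph_arc_sym[OF G]] by (auto simp: H_def)
    moreover have "pair_wf_digraph H"
      by unfold_locales (auto simp: H_def)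
    ultimately show ?thesis
      unfolding subgraph_def by (auto simp: wf_digraph_wp_iff compatible_def intro: pair_wf_digraph)
  qed
  ultimately show False
    using free unfolding diamond_free_def by blast
qed

text \<open>In a loop-free graph the three vertices of a closed 3-walk are distinct, so these walks
  are genuine triangles.\<close>

definition triangle_verts :: "'a pair_pre_digraph \<Rightarrow> 'a set" where
  "triangle_verts G = {v. \<exists>x y. (v, x) \<in> parcs G \<and> (x, y) \<in> parcs G \<and> (y, v) \<in> parcs G}"

lemma triangle_verts_subset:
  assumes "pair_graph G"
  shows "triangle_verts G \<subseteq> pverts G"
proof -
  interpret pair_graph G by fact
  show ?thesis unfolding triangle_verts_def using in_arcsD1 by auto
qed

text \<open>An ordered pair \<open>(u, v)\<close> extends to at most one closed 3-walk, and only if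
  both ends lie on triangles. Writing this bound as a product of two indicators lets the double sum
  factor.\<close>

lemma closed_3_walks_le:
  assumes G: "pair_graph G" and free: "diamond_free G"
  defines "a \<equiv> \<lambda>u v. if (u, v) \<in> parcs G then 1 else 0 :: real"
  shows "(\<Sum>u\<in>pverts G. \<Sum>v\<in>pverts G. \<Sum>w\<in>pverts G. a u v * a v w * a w u) \<le> (card (triangle_verts G))\<^sup>2"
proof -
  interpret pair_graph G by fact
  note fin = pair_finite_verts
  let ?V = "pverts G" and ?T = "triangle_verts G"
  have one: "(\<Sum>w\<in>?V. a u v * a v w * a w u) \<le> (if u \<in> ?T then 1 else 0) * (if v \<in> ?T then 1 else 0)"
    for u v
  proof (cases "\<exists>w. (u, v) \<in> parcs G \<and> (v, w) \<in> parcs G \<and> (w, u) \<in> parcs G")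
    case True
    then obtain w0 where w0: "(u, v) \<in> parcs G" "(v, w0) \<in> parcs G" "(w0, u) \<in> parcs G" by blast
    have uniq: "w = w0" if "(v, w) \<in> parcs G" "(w, u) \<in> parcs G" for w
      using diamond_free_common_neighbour_unique[OF G free w0(1)] that w0 pair_graph_arc_sym[OF G] by blast
    have "a u v * a v w * a w u \<le> (if w = w0 then 1 else 0)" for w
      using uniq[of w] by (cases "w = w0") (auto simp: a_def)
    then have "(\<Sum>w\<in>?V. a u v * a v w * a w u) \<le> (\<Sum>w\<in>?V. if w = w0 then 1 else 0)"
      by (intro sum_mono)
    also have "\<dots> \<le> 1" using fin by (simp add: sum.delta)
    finally show ?thesis
      using w0 by (auto simp: triangle_verts_def)
  next
    case False
    then have "(\<Sum>w\<in>?V. a u v * a v w * a w u) = 0"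
      by (intro sum.neutral) (auto simp: a_def)
    then show ?thesis by simp
  qed
  have T: "(\<Sum>u\<in>?V. if u \<in> ?T then 1 else 0 :: real) = card ?T"
    using triangle_verts_subset[OF G] fin by (simp add: sum.If_cases Int_absorb1)
  have "(\<Sum>u\<in>?V. \<Sum>v\<in>?V. \<Sum>w\<in>?V. a u v * a v w * a w u)
      \<le> (\<Sum>u\<in>?V. \<Sum>v\<in>?V. (if u \<in> ?T then 1 else 0) * (if v \<in> ?T then 1 else 0))"
    by (intro sum_mono one)
  also have "\<dots> = (\<Sum>u\<in>?V. if u \<in> ?T then 1 else 0) * (\<Sum>v\<in>?V. if v \<in> ?T then 1 else 0)"
    by (simp only: sum_product)
  finally show ?thesis by (simp only: T) (simp add: power2_eq_square)
qed

section \<open>Clique orders and the lower bound for the right-hand side\<close>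

lemma card_le_clique_order_at:
  assumes G: "pair_graph G" and K: "is_clique G K" "v \<in> K"
  shows "card K \<le> clique_order_at G v"
proof -
  interpret pair_graph G by fact
  \<comment> \<open>\<open>Max\<close> bounds its members only over a finite set.\<close>
  have "{card K | K. is_clique G K \<and> v \<in> K} \<subseteq> card ` Pow (pverts G)"
    by (auto simp: is_clique_def)
  then have "finite {card K | K. is_clique G K \<and> v \<in> K}"
    using pair_finite_verts finite_subset by blast
  then show ?thesis
    unfolding clique_order_at_def using K by (intro Max_ge) auto
qed

lemma connected_has_neighbour:
  assumes G: "pair_graph G" and conn: "Digraph_Component.connected (with_proj G)"
    and v: "v \<in> pverts G" and n: "card (pverts G) \<ge> 2"
  obtains w where "(v, w) \<in> parcs G"
proof -
  interpret pair_graph G by fact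
  have "pverts G \<noteq> {v}" using n by auto
  then obtain u where u: "u \<in> pverts G" "u \<noteq> v"
    using v by blast
  have "v \<rightarrow>\<^sup>*\<^bsub>mk_symmetric (with_proj G)\<^esub> u"
    using conn u v unfolding connected_def strongly_connected_def by simp
  \<comment> \<open>Connectedness speaks about the symmetric closure, which has the same
    reachability because the arcs are already symmetric.\<close>
  then have "v \<rightarrow>\<^sup>*\<^bsub>with_proj G\<^esub> u"
    using reachable_mk_symmetric_eq[OF pair_sym_arcs] by simp
  then show ?thesis
    using u that by (cases rule: converse_reachable_cases) auto
qed

text \<open>An edge at every vertex gives a summand of at least 1/2; on a triangle it is at least
  2/3 = 1/2 + 1/6.\<close>

lemma clique_sum_ge:
  assumes G: "pair_graph G" and conn: "Digraph_Component.connected (with_proj G)"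
    and n: "card (pverts G) \<ge> 2"
  shows "card (pverts G) / 2 + card (triangle_verts G) / 6
    \<le> (\<Sum>v\<in>pverts G. 1 - 1 / real (clique_order_at G v))"
proof -
  interpret pair_graph G by fact
  let ?V = "pverts G" and ?T = "triangle_verts G" and ?c = "clique_order_at G"
  have irr: "x \<noteq> y" if "(x, y) \<in> parcs G" for x y
    using pair_no_loops[OF that] by simp
  note sym = pair_graph_arc_sym[OF G]
  have two: "2 \<le> ?c v" if v: "v \<in> ?V" for v
  proof -
    obtain w where w: "(v, w) \<in> parcs G"
      using connected_has_neighbour[OF G conn v n] .
    then have "is_clique G {v, w}"
      using sym in_arcsD2 v by (auto simp: is_clique_def)
    then show ?thesis
      using card_le_clique_order_at[OF G, of "{v, w}" v] irr[OF w] by simp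
  qed
  have three: "3 \<le> ?c v" if v: "v \<in> ?T" for v
  proof -
    obtain x y where xy: "(v, x) \<in> parcs G" "(x, y) \<in> parcs G" "(y, v) \<in> parcs G"
      using v unfolding triangle_verts_def by blast
    then have "is_clique G {v, x, y}"
      using sym in_arcsD1 by (auto simp: is_clique_def)
    moreover have "card {v, x, y} = 3"
      using irr[OF xy(1)] irr[OF xy(2)] irr[OF xy(3)] by simp
    ultimately show ?thesis
      using card_le_clique_order_at[OF G, of "{v, x, y}" v] by simp
  qed
  have pt: "1 / 2 + (if v \<in> ?T then 1 / 6 else 0) \<le> 1 - 1 / real (?c v)" if v: "v \<in> ?V" for v
  proof (cases "v \<in> ?T")
    case True
    then have "1 / real (?c v) \<le> 1 / 3" using three[OF True] by (intro divide_left_mono) auto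
    then show ?thesis using True by simp
  next
    case False
    have "1 / real (?c v) \<le> 1 / 2" using two[OF v] by (intro divide_left_mono) auto
    then show ?thesis using False by simp
  qed
  have "card ?V / 2 + card ?T / 6 = (\<Sum>v\<in>?V. 1 / 2 + (if v \<in> ?T then 1 / 6 else 0 :: real))"
    using triangle_verts_subset[OF G] pair_finite_verts
    by (simp add: sum.distrib sum.If_cases Int_absorb1)
  also have "\<dots> \<le> (\<Sum>v\<in>?V. 1 - 1 / real (?c v))"
    by (intro sum_mono pt)
  finally show ?thesis .
qed

theorem theorem3p3:
  fixes G :: "'a pair_pre_digraph"
  assumes "pair_graph G"
    and "Digraph_Component.connected (with_proj G)"
    and "diamond_free G"
    and "card (pverts G) \<ge> 42"
  shows "sqrt (s_plus G) \<le> (\<Sum>v\<in>pverts G. 1 - 1 / real (clique_order_at G v))"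
proof -
  interpret pair_graph G by fact
  let ?V = "pverts G" and ?T = "triangle_verts G"
  obtain vs where vs: "distinct vs" "set vs = ?V"
    using pair_finite_verts finite_distinct_list by metis
  define n where "n = length vs"
  have n: "n = card ?V" unfolding n_def using vs distinct_card by metis
  define a where "a = (\<lambda>u v. if (u, v) \<in> parcs G then 1 else 0 :: real)"
  define A where "A = adjacency_matrix_wrt G vs"
  have A: "A \<in> carrier_mat n n" by (simp add: A_def adjacency_matrix_wrt_def n_def)
  have idx: "A $$ (i, j) = a (vs ! i) (vs ! j)" if "i < n" "j < n" for i j
    using that by (simp add: A_def adjacency_matrix_wrt_def n_def a_def)
  have a_sym: "a u v = a v u" for u v
    unfolding a_def using pair_graph_arc_sym[OF assms(1)] by auto
  have sym: "transpose_mat A = A"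
    using A by (intro eq_matI) (auto simp: idx a_sym)
  have reindex: "(\<Sum>i<n. f (vs ! i)) = (\<Sum>v\<in>?V. f v)" for f :: "'a \<Rightarrow> real"
    using sum.reindex_bij_betw[OF bij_betw_nth[OF vs(1) refl refl], of f] vs(2) by (simp add: n_def)
  obtain es where es: "char_poly A = (\<Prod>e\<leftarrow>es. [:- e, 1:])" "length es = n"
    using char_poly_real_symmetric_splits[OF A sym] .
  have "proots (char_poly A) = mset es"
    unfolding es(1) by (rule proots_prod_linear_factors)
  then have s_plus: "s_plus G = (\<Sum>e\<leftarrow>filter (\<lambda>e. e > 0) es. e\<^sup>2)"
    unfolding s_plus_def adjacency_eigenvalues_def char_poly_adjacency_matrix[OF vs] A_def
    by (simp flip: mset_filter mset_map sum_mset_sum_list)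
  have A2: "(A ^\<^sub>m 2) $$ (i, j) = (\<Sum>k<n. A $$ (i, k) * A $$ (k, j))" if "i < n" "j < n" for i j
    using A that by (simp add: numeral_2_eq_2 index_mult_mat_sum[OF A A] del: index_mult_mat)
  have "(\<Sum>e\<leftarrow>es. e\<^sup>2) = (\<Sum>i<n. (A ^\<^sub>m 2) $$ (i, i))"
    by (rule trace_pow_eq_sum_eigenvalues[OF A es(1), symmetric])
  \<comment> \<open>For a symmetric 0/1 matrix the diagonal of the square consists of the row sums,
    that is, the vertex degrees.\<close>
  also have "\<dots> = (\<Sum>i<n. \<Sum>j<n. A $$ (i, j))"
    using pair_graph_arc_sym[OF assms(1)]
    by (intro sum.cong refl) (auto simp: A2 idx a_def intro!: sum.cong)
  finally have squares: "(\<Sum>e\<leftarrow>es. e\<^sup>2) = (\<Sum>i<n. \<Sum>j<n. A $$ (i, j))" .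
  have "(\<Sum>e\<leftarrow>es. e ^ 3) = (\<Sum>i<n. (A ^\<^sub>m 3) $$ (i, i))"
    by (rule trace_pow_eq_sum_eigenvalues[OF A es(1), symmetric])
  also have "\<dots> = (\<Sum>i<n. (A * A ^\<^sub>m 2) $$ (i, i))"
    using A by (simp add: numeral_3_eq_3 numeral_2_eq_2 assoc_mult_mat[of _ n n _ n _ n] del: index_mult_mat)
  also have "\<dots> = (\<Sum>i<n. \<Sum>j<n. A $$ (i, j) * (\<Sum>k<n. A $$ (j, k) * A $$ (k, i)))"
    using A by (intro sum.cong refl) (simp add: index_mult_mat_sum[of _ n n _ n] A2 del: index_mult_mat)
  also have "\<dots> = (\<Sum>i<n. \<Sum>j<n. \<Sum>k<n.
      a (vs ! i) (vs ! j) * a (vs ! j) (vs ! k) * a (vs ! k) (vs ! i))"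
    by (simp add: sum_distrib_left idx mult.assoc)
  also have "\<dots> = (\<Sum>u\<in>?V. \<Sum>v\<in>?V. \<Sum>w\<in>?V. a u v * a v w * a w u)"
    by (simp only: reindex[symmetric])
  also have "\<dots> \<le> (card ?T)\<^sup>2"
    unfolding a_def by (rule closed_3_walks_le[OF assms(1,3)])
  finally have cubes: "(\<Sum>e\<leftarrow>es. e ^ 3) \<le> (real (card ?T))\<^sup>2" by simp
  have ne: "set es \<noteq> {}" using es(2) n assms(4) by auto
  \<comment> \<open>The maximum is attained at some \<open>e0\<close> of either sign. With
    \<open>squares\<close>, the spectral radius bound becomes the hypothesis on \<open>e0\<close> in
    \<open>sum_squares_pos_le\<close>.\<close>
  define \<rho> where "\<rho> = Max (abs ` set es)"
  have "\<rho> \<in> abs ` set es" unfolding \<rho>_def using ne by (intro Max_in) auto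
  then obtain e0 where e0: "e0 \<in> set es" "\<rho> = \<bar>e0\<bar>" by auto
  have "\<bar>e\<bar> \<le> \<rho>" if "e \<in> set es" for e
    unfolding \<rho>_def using that by (intro Max_ge) auto
  then have "(\<Sum>i<n. \<Sum>j<n. A $$ (i, j)) \<le> n * \<rho>"
    using e0 by (intro sum_entries_le_spectral_radius[OF A sym es]) auto
  then have "s_plus G \<le> (real n / 2 + card ?T / 6)\<^sup>2"
    unfolding s_plus using assms(4) n squares cubes e0
    by (intro sum_squares_pos_le) auto
  then have "sqrt (s_plus G) \<le> real n / 2 + card ?T / 6"
    by (intro real_le_lsqrt) auto
  also have "\<dots> \<le> (\<Sum>v\<in>?V. 1 - 1 / real (clique_order_at G v))"
    using clique_sum_ge[OF assms(1,2)] assms(4) n by simp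
  finally show ?thesis .
qed

end
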